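(* Let $N=\{1,\dots,n\}$ be a finite set of agents, $A$ a non-empty finite set of objects, and $\succ_A=(\succ_a)_{a\in A}$ a priority structure. On the domain $\mathbb{L}^n(A)$ (every object acceptable to every agent), the FPTTC rule $T^{\succ_A}$ satisfies dual ownership if and only if it is acyclic, i.e., if and only if the priority structure $\succ_A$ contains no priority cycle.
   Context: **Setting.** $N=\{1,\dots,n\}$ is a finite set of agents, $A$ a non-empty finite set of objects, and $a_0\notin A$ the outside option. An allocation is a function $\mu:N\to A\cup\{a_0\}$ with $|\mu^{-1}(a)|\le 1$ for all $a\in A$; $\mathcal{M}$ is the set of allocations. For a finite set $X$, $\mathbb{L}(X)$ is the set of strict linear orders on $X$; a preference is an element of $\mathbb{L}(A\cup\{a_0\})$. By abuse of notation, $\mathbb{L}(A)=\{P\in\mathbb{L}(A\cup\{a_0\}) : a\,P\,a_0 \text{ for all } a\in A\}$, and $\mathbb{L}^n(A)$ is its $n$-fold product (preference profiles $P_N=(P_1,\dots,P_n)$). Object $a$ is acceptable to $i$ if $a\,P_i\,a_0$. A priority structure is a collection $\succ_A=(\succ_a)_{a\in A}$ with $\succ_a\in\mathbb{L}(N)$. For $\succ\,\in\mathbb{L}(N)$, $\tau(\succ,N')$ is the $\succ$-maximal agent in $N'\subseteq N$, $\tau(\succ)=\tau(\succ,N)$, and $U(i,\succ)=\{j\in N: j\succ i\}$. **FPTTC rule.** The fixed priority top trading cycles (FPTTC) rule $T^{\succ_A}$ associated with $\succ_A$ is computed at a profile $P_N$ in steps. At Step $s$, let $N_s(P_N)$ and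 $A_s(P_N)$ be the sets of agents and objects remaining after Step $s-1$ (so $N_1(P_N)=N$, $A_1(P_N)=A$). Each $a\in A_s(P_N)$ is owned by $\tau(\succ_a,N_s(P_N))$. Form the directed graph on $N_s(P_N)$ in which each agent $i$ points to the owner of her most preferred acceptable object in $A_s(P_N)$, or to herself if no object in $A_s(P_N)$ is acceptable to her. Each agent in a cycle of this graph (self-loops included) is assigned her most preferred element of $A_s(P_N)\cup\{a_0\}$; assigned agents and assigned objects are removed. The procedure is repeated until all agents or all objects are assigned; any agent unassigned at the end receives $a_0$. **Dual ownership.** On a domain $\mathcal{P}_N$, $T^{\succ_A}$ satisfies dual ownership if for all $P_N\in\mathcal{P}_N$ and every step $s$ of the procedure at $P_N$, the set of owners $\{\tau(\succ_a,N_s(P_N)) : a\in A_s(P_N)\}$ has at most two elements. **Acyclicity.** A tuple $[(i_1,i_2,i_3),(a_1,a_2,a_3)]$ with $i_1,i_2,i_3\in N$ distinct and $a_1,a_2,a_3\in A$ distinct is a priority cycle in $\succ_A$ if either $\tau(\succ_{a_h})=i_h$ for $h=1,2,3$, or there exist (for some $t\ge 4$) distinct agents $i_4,\dots,i_t\in N\setminus\{i_1,i_2,i_3\}$ and distinct objects $a_4,\dots,a_t\in A\setminus\{a_1,a_2,a_3\}$ such that $U(i_h,\succ_{a_h})\subseteq\{i_4,\dots,i_t\}$ for all $h=1,\dots,t$. A priority structure is acyclic if it contains no priority cycle; $T^{\succ_A}$ is called acyclic if $\succ_A$ is acyclic. *)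

theory Defs
  imports "HOL-Library.FuncSet"
begin

(* Orders are relations, best element first: (x, y) \<in> r reads "x r y".  The library predicate
   does not confine r to X \<times> X, hence the inclusion. *)
definition linear_orders :: "'b set \<Rightarrow> 'b rel set" where
  "linear_orders X = {r. r \<subseteq> X \<times> X \<and> strict_linear_order_on X r}"

(* Meaningful when X is a finite non-empty subset of the set that r orders. *)
definition top_elem :: "'b rel \<Rightarrow> 'b set \<Rightarrow> 'b" where
  "top_elem r X = (THE x. x \<in> X \<and> (\<forall>y\<in>X - {x}. (x, y) \<in> r))"

definition upper_agents :: "'i set \<Rightarrow> 'i \<Rightarrow> 'i rel \<Rightarrow> 'i set" where
  "upper_agents N i r = {j \<in> N. (j, i) \<in> r}"

(* The set A \<union> {a0} is the option type over A: Some a is the object a, None the outside option. *)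
definition with_outside :: "'a set \<Rightarrow> 'a option set" where
  "with_outside A = insert None (Some ` A)"

definition all_acceptable_prefs :: "'a set \<Rightarrow> 'a option rel set" where
  "all_acceptable_prefs A =
     {P \<in> linear_orders (with_outside A). \<forall>a\<in>A. (Some a, None) \<in> P}"

definition all_acceptable_profiles :: "'i set \<Rightarrow> 'a set \<Rightarrow> ('i \<Rightarrow> 'a option rel) set" where
  "all_acceptable_profiles N A = (\<Pi>\<^sub>E i\<in>N. all_acceptable_prefs A)"

definition owner :: "('a \<Rightarrow> 'i rel) \<Rightarrow> 'i set \<Rightarrow> 'a \<Rightarrow> 'i" where
  "owner prio N a = top_elem (prio a) N"

definition choice :: "('i \<Rightarrow> 'a option rel) \<Rightarrow> 'a set \<Rightarrow> 'i \<Rightarrow> 'a option" where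
  "choice P A i = top_elem (P i) (with_outside A)"

(* The choice is None exactly when no object of A is acceptable to i; otherwise it is i's most
   preferred acceptable object in A. *)
definition points_to :: "('a \<Rightarrow> 'i rel) \<Rightarrow> ('i \<Rightarrow> 'a option rel) \<Rightarrow> 'i set \<Rightarrow> 'a set \<Rightarrow> 'i \<Rightarrow> 'i" where
  "points_to prio P N A i = (case choice P A i of None \<Rightarrow> i | Some a \<Rightarrow> owner prio N a)"

definition pointing_graph :: "('a \<Rightarrow> 'i rel) \<Rightarrow> ('i \<Rightarrow> 'a option rel) \<Rightarrow> 'i set \<Rightarrow> 'a set \<Rightarrow> 'i rel" where
  "pointing_graph prio P N A = {(i, points_to prio P N A i) | i. i \<in> N}"

definition agents_in_cycles :: "('a \<Rightarrow> 'i rel) \<Rightarrow> ('i \<Rightarrow> 'a option rel) \<Rightarrow> 'i set \<Rightarrow> 'a set \<Rightarrow> 'i set" where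
  "agents_in_cycles prio P N A = {i \<in> N. (i, i) \<in> (pointing_graph prio P N A)\<^sup>+}"

definition fpttc_step ::
  "('a \<Rightarrow> 'i rel) \<Rightarrow> ('i \<Rightarrow> 'a option rel) \<Rightarrow> 'i set \<times> 'a set \<Rightarrow> 'i set \<times> 'a set" where
  "fpttc_step prio P = (\<lambda>(N, A).
     if N = {} \<or> A = {} then (N, A)
     else let C = agents_in_cycles prio P N A
          in (N - C, {a \<in> A. Some a \<notin> choice P A ` C}))"

(* Agents and objects remaining after s steps, i.e. at the start of Step s + 1. *)
definition remaining ::
  "('a \<Rightarrow> 'i rel) \<Rightarrow> 'i set \<Rightarrow> 'a set \<Rightarrow> ('i \<Rightarrow> 'a option rel) \<Rightarrow> nat \<Rightarrow> 'i set \<times> 'a set" where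
  "remaining prio N A P s = (fpttc_step prio P ^^ s) (N, A)"

(* The procedure has a further step exactly when both agents and objects remain. *)
definition fpttc_dual_ownership ::
  "('a \<Rightarrow> 'i rel) \<Rightarrow> 'i set \<Rightarrow> 'a set \<Rightarrow> ('i \<Rightarrow> 'a option rel) set \<Rightarrow> bool" where
  "fpttc_dual_ownership prio N A D \<longleftrightarrow>
     (\<forall>P\<in>D. \<forall>s N' A'. remaining prio N A P s = (N', A') \<longrightarrow> N' \<noteq> {} \<longrightarrow> A' \<noteq> {} \<longrightarrow>
        card (owner prio N' ` A') \<le> 2)"

definition priority_cycle ::
  "('a \<Rightarrow> 'i rel) \<Rightarrow> 'i set \<Rightarrow> 'a set \<Rightarrow> 'i \<times> 'i \<times> 'i \<Rightarrow> 'a \<times> 'a \<times> 'a \<Rightarrow> bool" where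
  "priority_cycle prio N A = (\<lambda>(i1, i2, i3) (a1, a2, a3).
     {i1, i2, i3} \<subseteq> N \<and> distinct [i1, i2, i3] \<and>
     {a1, a2, a3} \<subseteq> A \<and> distinct [a1, a2, a3] \<and>
     ((top_elem (prio a1) N = i1 \<and> top_elem (prio a2) N = i2 \<and> top_elem (prio a3) N = i3) \<or>
      (\<exists>(t::nat) i a. t \<ge> 4 \<and>
         i 1 = i1 \<and> i 2 = i2 \<and> i 3 = i3 \<and> a 1 = a1 \<and> a 2 = a2 \<and> a 3 = a3 \<and>
         inj_on i {4..t} \<and> i ` {4..t} \<subseteq> N - {i1, i2, i3} \<and>
         inj_on a {4..t} \<and> a ` {4..t} \<subseteq> A - {a1, a2, a3} \<and>
         (\<forall>h\<in>{1..t}. upper_agents N (i h) (prio (a h)) \<subseteq> i ` {4..t}))))"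

definition acyclic_priority :: "('a \<Rightarrow> 'i rel) \<Rightarrow> 'i set \<Rightarrow> 'a set \<Rightarrow> bool" where
  "acyclic_priority prio N A \<longleftrightarrow> \<not> (\<exists>is as. priority_cycle prio N A is as)"

end

theory Submission
  imports Defs
begin

text \<open>
  Call a set \<open>I\<close> of agents, with an injection \<open>f\<close> from \<open>I\<close> into the objects, self-supporting if only
  members of \<open>I\<close> have a higher priority than \<open>i \<in> I\<close> for \<open>f i\<close>. A priority cycle amounts to a
  self-supporting \<open>I\<close> such that, once \<open>I\<close> and \<open>f ` I\<close> have left, the other objects have at least
  three owners.

  The agents who have left before any step are self-supporting: let \<open>f i\<close> be the object through
  which the predecessor of \<open>i\<close> in her trading cycle pointed to \<open>i\<close>. Conversely, a
  self-supporting \<open>I\<close> leaves first, with exactly the objects \<open>f ` I\<close>, if each \<open>i \<in> I\<close> likes \<open>f i\<close>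
  best and all other agents like the objects of \<open>f ` I\<close> best: as long as some of \<open>I\<close> is
  present, everybody points into \<open>I\<close>.
\<close>

section \<open>Linear orders\<close>

lemma linear_ordersD:
  assumes "r \<in> linear_orders X"
  shows "trans r" "irrefl r" "total_on X r"
  using assms by (auto simp: linear_orders_def strict_linear_order_on_def)

lemma linear_orders_asym:
  assumes "r \<in> linear_orders X" "(x, y) \<in> r"
  shows "(y, x) \<notin> r"
  using linear_ordersD[OF assms(1)] assms(2) by (meson irreflD transD)

lemma top_elem_eqI:
  assumes "r \<in> linear_orders X" "x \<in> Y" "\<And>y. y \<in> Y \<Longrightarrow> y \<noteq> x \<Longrightarrow> (x, y) \<in> r"
  shows "top_elem r Y = x"
  unfolding top_elem_def
proof (rule the_equality)
  show "x \<in> Y \<and> (\<forall>y\<in>Y - {x}. (x, y) \<in> r)"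
    using assms by auto
  show "z = x" if "z \<in> Y \<and> (\<forall>y\<in>Y - {z}. (z, y) \<in> r)" for z
    using that assms linear_orders_asym[OF assms(1)] by blast
qed

lemma ex_top_elem:
  assumes "r \<in> linear_orders X" "finite Y" "Y \<noteq> {}" "Y \<subseteq> X"
  shows "\<exists>x\<in>Y. \<forall>y\<in>Y - {x}. (x, y) \<in> r"
  using assms(2-4)
proof (induction Y rule: finite_ne_induct)
  case (singleton x)
  then show ?case by simp
next
  case (insert z Y)
  then obtain x where x: "x \<in> Y" "\<forall>y\<in>Y - {x}. (x, y) \<in> r" by auto
  note r = linear_ordersD[OF assms(1)]
  from x insert.hyps insert.prems consider "(x, z) \<in> r" | "(z, x) \<in> r"
    using r(3) unfolding total_on_def by (metis insert_subset subsetD)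
  then show ?case
  proof cases
    case 1
    with x show ?thesis by auto
  next
    case 2
    with x have "\<forall>y\<in>insert z Y - {z}. (z, y) \<in> r"
      using transD[OF r(1)] by blast
    then show ?thesis by blast
  qed
qed

lemma top_elem:
  assumes "r \<in> linear_orders X" "finite Y" "Y \<noteq> {}" "Y \<subseteq> X"
  shows "top_elem r Y \<in> Y" "y \<in> Y \<Longrightarrow> y \<noteq> top_elem r Y \<Longrightarrow> (top_elem r Y, y) \<in> r"
proof -
  obtain x where "x \<in> Y" "\<forall>y\<in>Y - {x}. (x, y) \<in> r"
    using ex_top_elem[OF assms] by blast
  moreover from this have "top_elem r Y = x"
    by (intro top_elem_eqI[OF assms(1)]) auto
  ultimately show "top_elem r Y \<in> Y" "y \<in> Y \<Longrightarrow> y \<noteq> top_elem r Y \<Longrightarrow> (top_elem r Y, y) \<in> r"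
    by auto
qed

text \<open>Ranking by \<open>g\<close> leaves ties; an injection of the finite set \<open>X\<close>
  into the naturals breaks them.\<close>

lemma ex_linear_order_refining:
  fixes g :: "'b \<Rightarrow> nat"
  assumes "finite X"
  shows "\<exists>r\<in>linear_orders X. \<forall>x\<in>X. \<forall>y\<in>X. g x < g y \<longrightarrow> (x, y) \<in> r"
proof -
  obtain h :: "'b \<Rightarrow> nat" where h: "inj_on h X"
    using finite_imp_inj_to_nat_seg[OF assms] by blast
  let ?r = "{(x, y) \<in> X \<times> X. g x < g y \<or> g x = g y \<and> h x < h y}"
  have "trans ?r" by (auto intro!: transI)
  moreover have "irrefl ?r" by (auto simp: irrefl_def)
  moreover have "total_on X ?r"
    using h by (auto simp: total_on_def) (metis inj_onD linorder_neqE_nat)+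
  ultimately have "?r \<in> linear_orders X"
    by (auto simp: linear_orders_def strict_linear_order_on_def)
  then show ?thesis by (rule bexI[rotated]) auto
qed

section \<open>Preferences\<close>

lemma ex_pref_favouring:
  assumes "finite A"
  shows "\<exists>P\<in>all_acceptable_prefs A. \<forall>b\<in>A \<inter> B. \<forall>a\<in>A - B. (Some b, Some a) \<in> P"
proof -
  \<comment> \<open>Rank 2 for the outside option puts it below every object, inside or outside
    \<open>B\<close>, so all objects stay acceptable.\<close>
  let ?g = "\<lambda>x. (case x of None \<Rightarrow> 2 | Some a \<Rightarrow> if a \<in> B then 0 else 1) :: nat"
  have "finite (with_outside A)"
    using assms by (simp add: with_outside_def)
  from ex_linear_order_refining[OF this, of ?g] obtain P where
    P: "P \<in> linear_orders (with_outside A)"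
      "\<And>x y. x \<in> with_outside A \<Longrightarrow> y \<in> with_outside A \<Longrightarrow> ?g x < ?g y \<Longrightarrow> (x, y) \<in> P"
    by blast
  show ?thesis
  proof (intro bexI[of _ P] ballI)
    show "(Some b, Some a) \<in> P" if "b \<in> A \<inter> B" "a \<in> A - B" for a b
      using that by (intro P(2)) (auto simp: with_outside_def)
    show "P \<in> all_acceptable_prefs A"
      using P by (auto simp: all_acceptable_prefs_def with_outside_def)
  qed
qed

text \<open>Every object precedes \<open>None\<close>, so the best element of a non-empty set of
  remaining objects together with \<open>None\<close> is an object. Hence nobody points to herself
  for want of an acceptable object.\<close>

lemma choice_acceptable:
  assumes "finite A" "P i \<in> all_acceptable_prefs A" "A' \<subseteq> A" "A' \<noteq> {}"
  obtains a where "a \<in> A'" "choice P A' i = Some a"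
    "\<And>b. b \<in> A' \<Longrightarrow> b \<noteq> a \<Longrightarrow> (Some a, Some b) \<in> P i"
proof -
  let ?Y = "with_outside A'"
  have P: "P i \<in> linear_orders (with_outside A)" "\<And>a. a \<in> A \<Longrightarrow> (Some a, None) \<in> P i"
    using assms(2) by (auto simp: all_acceptable_prefs_def)
  have Y: "finite ?Y" "?Y \<noteq> {}" "?Y \<subseteq> with_outside A"
    using assms finite_subset by (auto simp: with_outside_def)
  note top = top_elem[OF P(1) Y]
  obtain b where b: "b \<in> A'" using assms(4) by blast
  have "top_elem (P i) ?Y \<noteq> None"
  proof
    assume "top_elem (P i) ?Y = None"
    then have "(None, Some b) \<in> P i"
      using top(2)[of "Some b"] b by (auto simp: with_outside_def)
    then show False
      using linear_orders_asym[OF P(1)] P(2) b assms(3) by blast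
  qed
  then obtain a where a: "top_elem (P i) ?Y = Some a" by blast
  show thesis
  proof
    show "a \<in> A'" using top(1) a by (auto simp: with_outside_def)
    show "choice P A' i = Some a" using a by (simp add: choice_def)
    show "(Some a, Some b) \<in> P i" if "b \<in> A'" "b \<noteq> a" for b
      using top(2)[of "Some b"] a that by (auto simp: with_outside_def)
  qed
qed

text \<open>An available object of \<open>B\<close> beats every object outside \<open>B\<close>.
  This is how preferences will steer the pointing graph.\<close>

lemma choice_favoured:
  assumes "finite A" "P i \<in> all_acceptable_prefs A"
    and B: "\<And>b a. b \<in> A \<inter> B \<Longrightarrow> a \<in> A - B \<Longrightarrow> (Some b, Some a) \<in> P i"
    and "A' \<subseteq> A" "A' \<inter> B \<noteq> {}"
  shows "\<exists>a\<in>A' \<inter> B. choice P A' i = Some a"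
proof -
  have "A' \<noteq> {}" using assms(5) by blast
  from choice_acceptable[where P = P and i = i, OF assms(1,2,4) this] obtain a where
    a: "a \<in> A'" "choice P A' i = Some a"
      "\<And>b. b \<in> A' \<Longrightarrow> b \<noteq> a \<Longrightarrow> (Some a, Some b) \<in> P i" by metis
  obtain b where b: "b \<in> A'" "b \<in> B" using assms(5) by blast
  have linear: "P i \<in> linear_orders (with_outside A)"
    using assms(2) by (simp add: all_acceptable_prefs_def)
  have "a \<in> B"
  proof (rule ccontr)
    assume "a \<notin> B"
    then have "(Some a, Some b) \<in> P i" "(Some b, Some a) \<in> P i"
      using a(1,3) B[of b a] b assms(4) by blast+
    then show False using linear_orders_asym[OF linear] by blast
  qed
  with a(1,2) show ?thesis by blast
qed

text \<open>The converse of a finite acyclic relation is well-founded, which would give an element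
  of \<open>J\<close> without successor in \<open>J\<close>; but \<open>p i\<close> is a successor
  of \<open>i\<close>.\<close>

lemma finite_function_has_cycle:
  assumes "finite J" "J \<noteq> {}" "p ` J \<subseteq> J"
  shows "\<exists>x\<in>J. (x, x) \<in> {(i, p i) | i. i \<in> J}\<^sup>+"
proof (rule ccontr)
  let ?r = "{(i, p i) | i. i \<in> J}"
  assume neg: "\<not> ?thesis"
  have "?r \<subseteq> J \<times> J" using assms(3) by blast
  then have "finite ?r" "?r\<^sup>+ \<subseteq> J \<times> J"
    using assms(1) finite_subset trancl_subset_Sigma by blast+
  moreover from this neg have "acyclic ?r" by (auto simp: acyclic_def)
  ultimately have "wf (?r\<inverse>)" by (simp add: finite_acyclic_wf_converse)
  then obtain z where "z \<in> J" "\<And>y. (y, z) \<in> ?r\<inverse> \<Longrightarrow> y \<notin> J"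
    using assms(2) by (meson ex_in_conv wfE_min)
  then show False using assms(3) by blast
qed

section \<open>Self-supporting sets of agents\<close>

locale priority_structure =
  fixes prio :: "'a \<Rightarrow> 'i rel" and N :: "'i set" and A :: "'a set"
  assumes finite_agents: "finite N" and finite_objects: "finite A"
    and prio_linear: "a \<in> A \<Longrightarrow> prio a \<in> linear_orders N"
begin

lemma owner_eqI:
  assumes "a \<in> A" "N' \<subseteq> N" "i \<in> N'" "upper_agents N i (prio a) \<inter> N' = {}"
  shows "owner prio N' a = i"
  unfolding owner_def
proof (rule top_elem_eqI[OF prio_linear[OF assms(1)] assms(3)])
  show "(i, j) \<in> prio a" if "j \<in> N'" "j \<noteq> i" for j
    using linear_ordersD(3)[OF prio_linear[OF assms(1)]] that assms(2-4)
    by (auto simp: upper_agents_def total_on_def)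
qed

lemma owner_in:
  assumes "a \<in> A" "N' \<subseteq> N" "N' \<noteq> {}"
  shows "owner prio N' a \<in> N'"
  using top_elem(1)[OF prio_linear[OF assms(1)] _ assms(3,2)] assms(2) finite_agents finite_subset
  by (auto simp: owner_def)

lemma upper_agents_owner:
  assumes "a \<in> A" "N' \<subseteq> N" "N' \<noteq> {}"
  shows "upper_agents N (owner prio N' a) (prio a) \<subseteq> N - N'"
proof -
  note lin = prio_linear[OF assms(1)]
  have "finite N'" using assms(2) finite_agents finite_subset by blast
  note top = top_elem(2)[OF lin this assms(3,2)]
  show ?thesis
    using top linear_orders_asym[OF lin] irreflD[OF linear_ordersD(2)[OF lin]]
    unfolding owner_def upper_agents_def by blast
qed

lemma owner_eqD:
  assumes "a \<in> A" "N' \<subseteq> N" "N' \<noteq> {}" "owner prio N' a = i"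
  shows "i \<in> N'" "upper_agents N i (prio a) \<subseteq> N - N'"
  using owner_in[OF assms(1-3)] upper_agents_owner[OF assms(1-3)] assms(4) by blast+

definition self_supporting :: "'i set \<Rightarrow> ('i \<Rightarrow> 'a) \<Rightarrow> bool" where
  "self_supporting I f \<longleftrightarrow>
     I \<subseteq> N \<and> inj_on f I \<and> f ` I \<subseteq> A \<and> (\<forall>i\<in>I. upper_agents N i (prio (f i)) \<subseteq> I)"

text \<open>Dual ownership is tested only while agents and objects remain; three owners guarantee
  that they do, although \<open>owner\<close> is a total function.\<close>

lemma card_owners_gt_2D:
  assumes "card (owner prio N' ` A') > 2"
  shows "N' \<noteq> {}" "A' \<noteq> {}"
proof -
  show "A' \<noteq> {}" using assms by auto
  show "N' \<noteq> {}"
  proof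
    assume "N' = {}"
    \<comment> \<open>With no agents left, \<open>top_elem\<close> has the same unspecified value
      for every object.\<close>
    then have "owner prio N' ` A' \<subseteq> {THE x. False}"
      by (auto simp: owner_def top_elem_def)
    then have "card (owner prio N' ` A') \<le> card {THE x :: 'i. False}"
      by (intro card_mono) auto
    with assms show False by simp
  qed
qed

section \<open>Passing between priority cycles and self-supporting sets\<close>

text \<open>Both forms of a priority cycle are covered: \<open>I\<close> is empty if the three
  agents have top priority at the outset, and otherwise \<open>I\<close> consists of the agents with
  index 4 to \<open>t\<close>.\<close>

lemma priority_cycle_imp_self_supporting:
  assumes "priority_cycle prio N A is as"
  shows "\<exists>I f. self_supporting I f \<and> card (owner prio (N - I) ` (A - f ` I)) > 2"
proof -
  obtain i1 i2 i3 a1 a2 a3 where eq: "is = (i1, i2, i3)" "as = (a1, a2, a3)"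
    by (metis prod_cases3)
  note cyc = assms[unfolded eq priority_cycle_def prod.case]
  have sub: "{i1, i2, i3} \<subseteq> N" "{a1, a2, a3} \<subseteq> A" 
    using cyc[THEN conjunct1] cyc[THEN conjunct2, THEN conjunct2, THEN conjunct1] .
  have card3: "card {i1, i2, i3} = 3" using cyc by auto
  have many: "\<exists>I f. self_supporting I f \<and> card (owner prio (N - I) ` (A - f ` I)) > 2"
    if "self_supporting I f" "{i1, i2, i3} \<subseteq> owner prio (N - I) ` (A - f ` I)" for I f
  proof -
    have "card {i1, i2, i3} \<le> card (owner prio (N - I) ` (A - f ` I))"
      using that(2) finite_objects by (intro card_mono) auto
    with card3 that(1) show ?thesis by (intro exI[of _ I] exI[of _ f]) auto
  qed
  from cyc[THEN conjunct2, THEN conjunct2, THEN conjunct2, THEN conjunct2] show ?thesis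
  proof (elim disjE exE conjE, goal_cases tops supported)
    case tops
    show ?thesis
    proof (rule many)
      show "self_supporting {} f" for f by (simp add: self_supporting_def)
      show "{i1, i2, i3} \<subseteq> owner prio (N - {}) ` (A - f ` {})" for f
        using tops sub(2) by (force simp: owner_def)
    qed
  next
    case (supported t i a)
    define I where "I = i ` {4..t}"
    \<comment> \<open>The map from the agent with index \<open>h\<close> to the object with index
      \<open>h\<close>; it is well-defined because \<open>i\<close> is injective on
      \<open>{4..t}\<close>.\<close>
    define f where "f = a \<circ> the_inv_into {4..t} i"
    have f_i: "f (i h) = a h" if "h \<in> {4..t}" for h
      using that supported(8) by (simp add: f_def the_inv_into_f_f)
    then have fI: "f ` I = a ` {4..t}" by (force simp: I_def image_image)
    have "self_supporting I f"
      unfolding self_supporting_def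
    proof (intro conjI ballI)
      show "I \<subseteq> N" "f ` I \<subseteq> A" using supported(9,11) fI unfolding I_def by blast+
      show "inj_on f I"
        using supported(10) f_i by (auto simp: I_def inj_on_def)
      show "upper_agents N j (prio (f j)) \<subseteq> I" if j: "j \<in> I" for j
      proof -
        obtain h where h: "h \<in> {4..t}" "j = i h" using j unfolding I_def by blast
        then have "upper_agents N (i h) (prio (a h)) \<subseteq> I"
          using bspec[OF supported(12), of h] by (simp add: I_def)
        with h f_i show ?thesis by simp
      qed
    qed
    moreover have "{i1, i2, i3} \<subseteq> owner prio (N - I) ` (A - f ` I)"
    proof -
      \<comment> \<open>Everyone above \<open>i h\<close> for \<open>a h\<close> belongs to
        \<open>I\<close>, so \<open>i h\<close> inherits \<open>a h\<close> once \<open>I\<close>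
        has left.\<close>
      have own: "i h \<in> owner prio (N - I) ` (A - f ` I)" if "h \<in> {1, 2, 3}" for h
      proof (rule image_eqI)
        have ih: "i h \<in> {i1, i2, i3}" and ah: "a h \<in> {a1, a2, a3}"
          using that supported(2-7) by auto
        show "a h \<in> A - f ` I" using ah fI supported(11) sub(2) by blast
        have "i h \<in> N - I" using ih supported(9) sub(1) unfolding I_def by blast
        moreover have "upper_agents N (i h) (prio (a h)) \<subseteq> I"
          using bspec[OF supported(12), of h] supported(1) that unfolding I_def by auto
        ultimately show "i h = owner prio (N - I) (a h)"
          using \<open>a h \<in> A - f ` I\<close> by (intro owner_eqI[symmetric]) auto
      qed
      show ?thesis using own[of 1] own[of 2] own[of 3] supported(2-4) by simp
    qed
    ultimately show ?thesis by (rule many)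
  qed
qed

text \<open>Three owners of the objects left over become the first three agents of the cycle, and an
  enumeration of \<open>I\<close> supplies the others. Whoever has priority over an owner for her
  object is no longer present, hence is in \<open>I\<close>.\<close>

lemma self_supporting_imp_priority_cycle:
  assumes "self_supporting I f" "card (owner prio (N - I) ` (A - f ` I)) > 2"
  shows "\<exists>is as. priority_cycle prio N A is as"
proof -
  note ne = card_owners_gt_2D(1)[OF assms(2)]
  obtain T where T: "T \<subseteq> owner prio (N - I) ` (A - f ` I)" "card T = 3"
    using obtain_subset_with_card_n[of 3] assms(2)
    by (metis Suc_leI eval_nat_numeral(3))
  then obtain i1 i2 i3 where ags: "T = {i1, i2, i3}" "distinct [i1, i2, i3]"
    by (auto simp: card_3_iff)
  with T obtain a1 a2 a3 where objs: "{a1, a2, a3} \<subseteq> A - f ` I"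
    and own: "owner prio (N - I) a1 = i1" "owner prio (N - I) a2 = i2" "owner prio (N - I) a3 = i3"
    by auto
  \<comment> \<open>An object has only one owner, so distinct owners force distinct objects.\<close>
  have dist: "distinct [a1, a2, a3]" using ags own by auto
  have sup: "I \<subseteq> N" "inj_on f I" "f ` I \<subseteq> A"
    "\<And>i. i \<in> I \<Longrightarrow> upper_agents N i (prio (f i)) \<subseteq> I"
    using assms(1) by (auto simp: self_supporting_def)
  have up: "i1 \<in> N - I" "i2 \<in> N - I" "i3 \<in> N - I" "upper_agents N i1 (prio a1) \<subseteq> I"
    "upper_agents N i2 (prio a2) \<subseteq> I" "upper_agents N i3 (prio a3) \<subseteq> I"
    using owner_eqD[OF _ _ ne own(1)] owner_eqD[OF _ _ ne own(2)] owner_eqD[OF _ _ ne own(3)] objs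
    by auto
  have "priority_cycle prio N A (i1, i2, i3) (a1, a2, a3)"
  proof (cases "I = {}")
    case True
    then show ?thesis
      using own ags(2) dist objs up by (auto simp: priority_cycle_def owner_def)
  next
    case False
    have "finite I" using sup(1) finite_agents finite_subset by blast
    with False have "card I > 0" by (simp add: card_gt_0_iff)
    \<comment> \<open>The indices 4 to \<open>t\<close> enumerate \<open>I\<close>, and
      \<open>t \<ge> 4\<close> since \<open>I\<close> is non-empty here. The empty \<open>I\<close>
      gave the first form of a priority cycle.\<close>
    define t where "t = card I + 3"
    have "card {4..t} = card I" by (simp add: t_def)
    then obtain e where e: "bij_betw e {4..t} I"
      using finite_same_card_bij[of "{4..t}" I] \<open>finite I\<close> by auto
    then have eI: "e ` {4..t} = I" and inj: "inj_on e {4..t}"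
      by (auto simp: bij_betw_def)
    define i where "i h = (if h = 1 then i1 else if h = 2 then i2 else if h = 3 then i3 else e h)"
      for h
    define a where
      "a h = (if h = 1 then a1 else if h = 2 then a2 else if h = 3 then a3 else f (e h))" for h
    have ia: "i h = e h" "a h = f (e h)" if "h \<in> {4..t}" for h
      using that by (auto simp: i_def a_def)
    then have iI: "i ` {4..t} = I" and aI: "a ` {4..t} = f ` I"
      unfolding eI[symmetric] image_image by (intro image_cong refl; simp)+
    have "inj_on i {4..t}" using inj_on_cong[of "{4..t}" i e] inj ia(1) by blast
    moreover have "inj_on a {4..t}"
      using inj_on_cong[of "{4..t}" a "f \<circ> e"] comp_inj_on[OF inj, of f] sup(2) eI ia(2) by simp
    moreover have "t \<ge> 4" using \<open>card I > 0\<close> by (simp add: t_def)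
    moreover have "upper_agents N (i h) (prio (a h)) \<subseteq> i ` {4..t}" if "h \<in> {1..t}" for h
    proof -
      from that consider "h = 1" | "h = 2" | "h = 3" | "h \<in> {4..t}" by fastforce
      then show ?thesis
      proof cases
        case 4
        then show ?thesis using sup(4)[of "e h"] eI unfolding iI ia[OF 4] by blast
      qed (use up iI in \<open>simp_all add: i_def a_def\<close>)
    qed
    moreover have "i 1 = i1" "i 2 = i2" "i 3 = i3" "a 1 = a1" "a 2 = a2" "a 3 = a3"
      by (auto simp: i_def a_def)
    moreover have "i ` {4..t} \<subseteq> N - {i1, i2, i3}" "a ` {4..t} \<subseteq> A - {a1, a2, a3}"
      unfolding iI aI using up objs sup by auto
    moreover have "{i1, i2, i3} \<subseteq> N" "{a1, a2, a3} \<subseteq> A" using up objs by auto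
    ultimately show ?thesis
      using ags(2) dist unfolding priority_cycle_def prod.case
      by (intro conjI disjI2 exI[of _ t] exI[of _ i] exI[of _ a] ballI)
  qed
  then show ?thesis by blast
qed

section \<open>Running the rule\<close>

text \<open>The witness is the object through which the predecessor of \<open>j\<close> points to
  \<open>j\<close>. The predecessor is in a cycle too, so this object leaves in the same
  step.\<close>

lemma cycle_agent_owns_chosen:
  assumes P: "P \<in> all_acceptable_profiles N A" and sub: "N' \<subseteq> N" "A' \<subseteq> A" "A' \<noteq> {}"
    and j: "j \<in> agents_in_cycles prio P N' A'"
  shows "\<exists>a\<in>A'. owner prio N' a = j \<and> Some a \<in> choice P A' ` agents_in_cycles prio P N' A'"
proof -
  let ?G = "pointing_graph prio P N' A'"
  from j have "(j, j) \<in> ?G\<^sup>+" by (simp add: agents_in_cycles_def)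
  \<comment> \<open>\<open>i\<close> is the last agent before \<open>j\<close> on the closed walk;
    moving the last edge to the front makes the walk start and end at \<open>i\<close>.\<close>
  then obtain i where i: "(j, i) \<in> ?G\<^sup>*" "(i, j) \<in> ?G" by (meson tranclD2)
  then have "(i, i) \<in> ?G\<^sup>+" by (rule rtrancl_into_trancl2[rotated])
  moreover have iN: "i \<in> N'" and pts: "points_to prio P N' A' i = j"
    using i(2) by (auto simp: pointing_graph_def)
  ultimately have C: "i \<in> agents_in_cycles prio P N' A'" by (simp add: agents_in_cycles_def)
  have "P i \<in> all_acceptable_prefs A"
    using P iN sub by (auto simp: all_acceptable_profiles_def)
  from choice_acceptable[where P = P and i = i, OF finite_objects this sub(2,3)] obtain a
    where "a \<in> A'" "choice P A' i = Some a" by metis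
  with pts C show ?thesis by (auto simp: points_to_def intro!: bexI[of _ a] image_eqI[of _ _ i])
qed

text \<open>Induction over the steps. An agent who leaves is matched with an object that she owns at
  that step, in general not the one that she receives. Everybody above her for it has left before,
  so the departed agents remain self-supporting.\<close>

lemma departed_self_supporting:
  assumes P: "P \<in> all_acceptable_profiles N A"
  shows "remaining prio N A P s = (N', A') \<Longrightarrow>
    N' \<subseteq> N \<and> A' \<subseteq> A \<and> (\<exists>f. self_supporting (N - N') f \<and> f ` (N - N') \<subseteq> A - A')"
proof (induction s arbitrary: N' A')
  case 0
  moreover have "self_supporting {} f" for f by (simp add: self_supporting_def)
  ultimately show ?case by (auto simp: remaining_def)
next
  case (Suc s)
  obtain M B where MB: "remaining prio N A P s = (M, B)" by fastforce
  from Suc.IH[OF this] obtain f where IH: "M \<subseteq> N" "B \<subseteq> A" "self_supporting (N - M) f" "f ` (N - M) \<subseteq> A - B"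
    by blast
  have step: "(N', A') = fpttc_step prio P (M, B)"
    using Suc.prems MB by (simp add: remaining_def)
  show ?case
  proof (cases "M = {} \<or> B = {}")
    case True
    then show ?thesis using step IH by (auto simp: fpttc_step_def)
  next
    case False
    let ?C = "agents_in_cycles prio P M B"
    have N': "N' = M - ?C" and A': "A' = {a \<in> B. Some a \<notin> choice P B ` ?C}"
      using step False by (auto simp: fpttc_step_def Let_def)
    have CM: "?C \<subseteq> M" by (auto simp: agents_in_cycles_def)
    \<comment> \<open>\<open>g\<close> is injective because \<open>j\<close> is recovered as the
      owner of \<open>g j\<close>, and \<open>g j\<close> leaves now because some cycle agent
      chooses it.\<close>
    obtain g where g: "\<And>j. j \<in> ?C \<Longrightarrow> g j \<in> B \<and> owner prio M (g j) = j \<and> Some (g j) \<in> choice P B ` ?C"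
      using cycle_agent_owns_chosen[OF P IH(1,2)] False by metis
    define f' where "f' j = (if j \<in> ?C then g j else f j)" for j
    have split: "N - N' = (N - M) \<union> ?C" using N' CM IH(1) by blast
    have out: "f' j = f j" "f j \<in> A - B" if "j \<in> N - M" for j
      using that CM IH(4) by (auto simp: f'_def)
    have inC: "f' j = g j" "g j \<in> B" if "j \<in> ?C" for j
      using that g by (auto simp: f'_def)
    have sub: "f' ` (N - N') \<subseteq> A - A'"
      unfolding split A' using out inC g IH(2) by auto
    have "self_supporting (N - N') f'"
      unfolding self_supporting_def
    proof (intro conjI ballI)
      show "N - N' \<subseteq> N" "f' ` (N - N') \<subseteq> A" using sub by auto
      have "inj_on f (N - M)" using IH(3) by (simp add: self_supporting_def)
      then have "inj_on f' (N - M)" using inj_on_cong[of "N - M" f' f] out(1) by blast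
      moreover have "inj_on f' ?C" using inC(1) g by (metis inj_onI)
      \<comment> \<open>Objects matched earlier are outside \<open>B\<close>, those matched in this
        step are in \<open>B\<close>.\<close>
      moreover have "f' ` (N - M) \<inter> f' ` ?C = {}" using out inC by fastforce
      ultimately show "inj_on f' (N - N')"
        unfolding split inj_on_Un by blast
      show "upper_agents N j (prio (f' j)) \<subseteq> N - N'" if j: "j \<in> N - N'" for j
      proof (cases "j \<in> ?C")
        case True
        then have "upper_agents N j (prio (g j)) \<subseteq> N - M"
          using owner_eqD(2)[of "g j" M j] g IH(1,2) False by blast
        then show ?thesis using inC(1)[OF True] split by auto
      next
        case False
        then have "j \<in> N - M" using j split by blast
        then show ?thesis
          using IH(3) out(1) split by (auto simp: self_supporting_def)
      qed
    qed
    with sub N' A' IH show ?thesis by blast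
  qed
qed

section \<open>Making a self-supporting set leave first\<close>

lemma ex_profile_favouring:
  assumes "self_supporting I f"
  shows "\<exists>P\<in>all_acceptable_profiles N A. \<forall>i\<in>N.
    \<forall>b\<in>A \<inter> (if i \<in> I then {f i} else f ` I). \<forall>a\<in>A - (if i \<in> I then {f i} else f ` I).
      (Some b, Some a) \<in> P i"
proof -
  let ?B = "\<lambda>i. if i \<in> I then {f i} else f ` I"
  have "\<forall>i. \<exists>P. P \<in> all_acceptable_prefs A \<and> (\<forall>b\<in>A \<inter> ?B i. \<forall>a\<in>A - ?B i. (Some b, Some a) \<in> P)"
    using ex_pref_favouring[OF finite_objects] by (simp only: Bex_def) blast
  then obtain Q where Q: "\<And>i. Q i \<in> all_acceptable_prefs A"
    "\<And>i. \<forall>b\<in>A \<inter> ?B i. \<forall>a\<in>A - ?B i. (Some b, Some a) \<in> Q i"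
    unfolding choice_iff by blast
  show ?thesis
    \<comment> \<open>Profiles are extensional functions on \<open>N\<close>, hence
      \<open>restrict\<close>.\<close>
    proof (rule bexI[of _ "restrict Q N"])
    show "restrict Q N \<in> all_acceptable_profiles N A"
      using Q(1) by (simp add: all_acceptable_profiles_def)
  qed (use Q(2) in simp)
qed

text \<open>The members of \<open>I\<close> may need several steps to leave, so the claim is made
  for every intermediate state: \<open>J\<close> is the part of \<open>I\<close> still present, and
  the others have taken their objects under \<open>f\<close>. Each step removes a non-empty part of
  \<open>J\<close> and nobody else, so induction on \<open>J\<close> reaches the empty set.\<close>

lemma self_supporting_departs:
  assumes sup: "self_supporting I f"
    and P: "P \<in> all_acceptable_profiles N A"
    and fav: "\<And>i b a. i \<in> N \<Longrightarrow> b \<in> A \<inter> (if i \<in> I then {f i} else f ` I) \<Longrightarrow>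
      a \<in> A - (if i \<in> I then {f i} else f ` I) \<Longrightarrow> (Some b, Some a) \<in> P i"
    and "J \<subseteq> I"
  shows "\<exists>s. (fpttc_step prio P ^^ s) (N - I \<union> J, A - f ` (I - J)) = (N - I, A - f ` I)"
proof -
  have I: "I \<subseteq> N" "inj_on f I" "f ` I \<subseteq> A" "\<And>i. i \<in> I \<Longrightarrow> upper_agents N i (prio (f i)) \<subseteq> I"
    using sup by (auto simp: self_supporting_def)
  have "finite J" using rev_finite_subset[OF finite_agents, of J] assms(4) I(1) by simp
  then show ?thesis using assms(4)
  proof (induction J rule: finite_psubset_induct)
    case (psubset J)
    show ?case
    proof (cases "J = {}")
      case True
      then show ?thesis by (auto intro!: exI[of _ 0])
    next
      case False
      let ?M = "N - I \<union> J" and ?B = "A - f ` (I - J)"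
      let ?C = "agents_in_cycles prio P ?M ?B" and ?G = "pointing_graph prio P ?M ?B"
      let ?p = "points_to prio P ?M ?B"
      have M: "?M \<subseteq> N" "?M \<noteq> {}" using I(1) psubset.prems False by auto
      have fJ: "f ` J \<subseteq> ?B" using psubset.prems I(2,3) unfolding inj_on_def by blast
      \<comment> \<open>An owner outside \<open>I\<close> would have priority over the present agent
        \<open>j\<close> for \<open>f j\<close>, but only members of \<open>I\<close> do.\<close>
      have own: "owner prio ?M (f j) \<in> J" if "j \<in> J" for j
      proof -
        have fj: "f j \<in> A" and jI: "j \<in> I" using that psubset.prems I(3) by auto
        note top = owner_eqD[OF fj M refl]
        show ?thesis
        proof (rule ccontr)
          assume "owner prio ?M (f j) \<notin> J"
          with top(1) have o: "owner prio ?M (f j) \<in> N - I" by blast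
          then have "owner prio ?M (f j) \<noteq> j" using jI by (metis DiffD2)
          moreover have "owner prio ?M (f j) \<notin> upper_agents N j (prio (f j))"
            using I(4)[OF jI] o by blast
          moreover have "j \<notin> upper_agents N (owner prio ?M (f j)) (prio (f j))"
            using top(2) that by blast
          moreover have "j \<in> N" "owner prio ?M (f j) \<in> N" using o jI I(1) by auto
          ultimately show False
            using linear_ordersD(3)[OF prio_linear[OF fj]]
            by (auto simp: upper_agents_def total_on_def)
        qed
      qed
      have pref: "P i \<in> all_acceptable_prefs A" if "i \<in> N" for i
        using P that by (auto simp: all_acceptable_profiles_def)
      have choose_J: "choice P ?B j = Some (f j)" if "j \<in> J" for j
      proof -
        have j: "j \<in> N" "j \<in> I" using that psubset.prems I(1) by auto
        have "\<exists>a\<in>?B \<inter> {f j}. choice P ?B j = Some a"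
        proof (rule choice_favoured[where P = P and i = j, OF finite_objects pref[OF j(1)]])
          show "(Some b, Some a) \<in> P j" if "b \<in> A \<inter> {f j}" "a \<in> A - {f j}" for a b
            using fav[OF j(1), of b a] j(2) that by auto
          show "?B \<inter> {f j} \<noteq> {}" using that fJ by blast
        qed blast
        then show ?thesis by blast
      qed
      \<comment> \<open>Outsiders choose within the image of \<open>I\<close> under
        \<open>f\<close>, and what remains of this image is the image of \<open>J\<close>.\<close>
      have choose: "\<exists>j\<in>J. choice P ?B i = Some (f j)" if "i \<in> ?M" for i
      proof (cases "i \<in> J")
        case True
        then show ?thesis using choose_J by blast
      next
        case outside: False
        then have i: "i \<in> N" "i \<notin> I" using that by auto
        have "\<exists>a\<in>?B \<inter> f ` I. choice P ?B i = Some a"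
        proof (rule choice_favoured[where P = P and i = i, OF finite_objects pref[OF i(1)]])
          show "(Some b, Some a) \<in> P i" if "b \<in> A \<inter> f ` I" "a \<in> A - f ` I" for a b
            using fav[OF i(1), of b a] i(2) that by auto
          show "?B \<inter> f ` I \<noteq> {}" using False fJ psubset.prems by blast
        qed blast
        then show ?thesis by blast
      qed
      \<comment> \<open>Every edge ends in \<open>J\<close>, so no cycle contains an agent outside
        \<open>J\<close>.\<close>
      have p: "?p i \<in> J" if "i \<in> ?M" for i
        using choose[OF that] own by (auto simp: points_to_def)
      then have "Range ?G \<subseteq> J" by (auto simp: pointing_graph_def)
      then have "Range (?G\<^sup>+) \<subseteq> J" by simp
      then have CJ: "?C \<subseteq> J" unfolding agents_in_cycles_def by blast
      \<comment> \<open>Since \<open>J\<close> is closed under pointing, it contains a cycle; thus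
        \<open>J\<close> strictly shrinks.\<close>
      have "?p ` J \<subseteq> J" using p by blast
      from finite_function_has_cycle[OF psubset.hyps False this] obtain x
        where x: "x \<in> J" "(x, x) \<in> {(i, ?p i) | i. i \<in> J}\<^sup>+" by blast
      have "{(i, ?p i) | i. i \<in> J} \<subseteq> ?G" by (auto simp: pointing_graph_def)
      from trancl_mono[OF x(2) this] have "x \<in> ?C"
        using x(1) by (simp add: agents_in_cycles_def)
      with CJ x(1) have "J - ?C \<subset> J" by blast
      from psubset.IH[OF this] psubset.prems obtain s where s:
        "(fpttc_step prio P ^^ s) (N - I \<union> (J - ?C), A - f ` (I - (J - ?C))) = (N - I, A - f ` I)"
        by blast
      \<comment> \<open>Each cycle agent takes her own \<open>f j\<close>, so the new state again
        has the form of the induction hypothesis.\<close>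
      have "choice P ?B ` ?C = Some ` f ` ?C"
        unfolding image_image using CJ choose_J by (intro image_cong) auto
      then have "{a \<in> ?B. Some a \<notin> choice P ?B ` ?C} = A - (f ` (I - J) \<union> f ` ?C)"
        by (auto simp only: inj_image_mem_iff[OF inj_Some])
      also have "f ` (I - J) \<union> f ` ?C = f ` (I - (J - ?C))"
        unfolding image_Un[symmetric] using CJ psubset.prems by (intro image_cong) blast+
      finally have "{a \<in> ?B. Some a \<notin> choice P ?B ` ?C} = A - f ` (I - (J - ?C))" .
      moreover have "?M - ?C = N - I \<union> (J - ?C)" using CJ psubset.prems by blast
      moreover have "?B \<noteq> {}" using fJ False by blast
      ultimately have "fpttc_step prio P (?M, ?B) = (N - I \<union> (J - ?C), A - f ` (I - (J - ?C)))"
        using M(2) unfolding fpttc_step_def Let_def prod.case by (simp only: if_False simp_thms)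
      with s have "(fpttc_step prio P ^^ Suc s) (?M, ?B) = (N - I, A - f ` I)"
        by (simp only: funpow_Suc_right comp_apply)
      then show ?thesis by blast
    qed
  qed
qed

section \<open>The equivalence\<close>

theorem dual_ownership_iff_acyclic:
  "fpttc_dual_ownership prio N A (all_acceptable_profiles N A) \<longleftrightarrow> acyclic_priority prio N A"
proof
  assume dual: "fpttc_dual_ownership prio N A (all_acceptable_profiles N A)"
  show "acyclic_priority prio N A"
    unfolding acyclic_priority_def
  proof
    assume "\<exists>is as. priority_cycle prio N A is as"
    then obtain I f where I: "self_supporting I f"
      and card: "card (owner prio (N - I) ` (A - f ` I)) > 2"
      using priority_cycle_imp_self_supporting by blast
    from ex_profile_favouring[OF I] obtain P where P: "P \<in> all_acceptable_profiles N A"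
      and "\<And>i b a. i \<in> N \<Longrightarrow> b \<in> A \<inter> (if i \<in> I then {f i} else f ` I) \<Longrightarrow>
        a \<in> A - (if i \<in> I then {f i} else f ` I) \<Longrightarrow> (Some b, Some a) \<in> P i" by blast
    \<comment> \<open>With \<open>J = I\<close> the run begins at the initial state and ends where
      three owners remain.\<close>
    from self_supporting_departs[OF I this, of I] obtain s
      where "(fpttc_step prio P ^^ s) (N - I \<union> I, A - f ` (I - I)) = (N - I, A - f ` I)" by blast
    moreover have "N - I \<union> I = N" using I by (auto simp: self_supporting_def)
    ultimately have "remaining prio N A P s = (N - I, A - f ` I)" by (simp add: remaining_def)
    with dual P card_owners_gt_2D[OF card] have "card (owner prio (N - I) ` (A - f ` I)) \<le> 2"
      unfolding fpttc_dual_ownership_def by blast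
    with card show False by simp
  qed
next
  assume acyc: "acyclic_priority prio N A"
  show "fpttc_dual_ownership prio N A (all_acceptable_profiles N A)"
    unfolding fpttc_dual_ownership_def
  proof (intro ballI allI impI)
    fix P s N' A'
    assume "P \<in> all_acceptable_profiles N A" "remaining prio N A P s = (N', A')"
    from departed_self_supporting[OF this] obtain f where sub: "N' \<subseteq> N" "A' \<subseteq> A"
      and f: "self_supporting (N - N') f" "f ` (N - N') \<subseteq> A - A'"
      by blast
    \<comment> \<open>The remaining objects avoid the values of \<open>f\<close> on the departed
      agents, so the owners at this step are among those that acyclicity bounds by two.\<close>
    have "N - (N - N') = N'" "A' \<subseteq> A - f ` (N - N')" using sub f(2) by blast+
    then have "owner prio N' ` A' \<subseteq> owner prio (N - (N - N')) ` (A - f ` (N - N'))"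
      by (simp add: image_mono)
    then have "card (owner prio N' ` A') \<le> card (owner prio (N - (N - N')) ` (A - f ` (N - N')))"
      using finite_objects by (intro card_mono) auto
    also have "\<dots> \<le> 2"
      using self_supporting_imp_priority_cycle[OF f(1)] acyc
      unfolding acyclic_priority_def by fastforce
    finally show "card (owner prio N' ` A') \<le> 2" .
  qed
qed

end

theorem theorem4p2:
  fixes n :: nat
    and A :: "'a set"
    and prio :: "'a \<Rightarrow> nat rel"
  assumes "finite A"
    and "A \<noteq> {}"
    and "\<And>a. a \<in> A \<Longrightarrow> prio a \<in> linear_orders {1..n}"
  shows "fpttc_dual_ownership prio {1..n} A (all_acceptable_profiles {1..n} A)
           \<longleftrightarrow> acyclic_priority prio {1..n} A"
proof -
  interpret priority_structure prio "{1..n}" A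
    using assms by unfold_locales auto
  show ?thesis by (rule dual_ownership_iff_acyclic)
qed

end
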